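(* Suppose $F:\mathbb R^d\to\mathbb R$ is $L_1$-smooth w.r.t. $\|\cdot\|_1$. Let $x^1,\dots,x^T\in\Delta_d$ be deterministic vectors and $a^1,\dots,a^T\in\Delta_d$ be random vectors such that $\mathbb E[a^t\mid a^{t-1},\dots,a^1]=x^t$ for all $t\in[T]$. Let $\bar x^T=\frac1T\sum_{t=1}^Tx^t$ and $\bar a^T=\frac1T\sum_{t=1}^Ta^t$. Then $$\big\|\mathbb E[\nabla F(\bar a^T)-\nabla F(\bar x^T)]\big\|_\infty\le\frac{4L_1}{\sqrt T}.$$
   Context: $\Delta_d=\{x\in\mathbb R^d:x_j\ge0,\ \sum_jx_j=1\}$. A differentiable $F$ is $L_1$-smooth w.r.t. $\|\cdot\|_1$ if $\|\nabla F(u)-\nabla F(u')\|_\infty\le L_1\|u-u'\|_1$ for all $u,u'$. *)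

theory Defs
  imports "HOL-Probability.Probability"
begin

definition prob_simplex :: "(real ^ 'n) set" where
  "prob_simplex = {x. (\<forall>j. 0 \<le> x $ j) \<and> (\<Sum>j\<in>UNIV. x $ j) = 1}"

definition l1norm :: "real ^ 'n \<Rightarrow> real" where
  "l1norm x = (\<Sum>j\<in>UNIV. \<bar>x $ j\<bar>)"

(* Only meaningful where F is differentiable. *)
definition grad :: "(real ^ 'n \<Rightarrow> real) \<Rightarrow> real ^ 'n \<Rightarrow> real ^ 'n" where
  "grad F u = (THE D. GDERIV F u :> D)"

lemma grad_eqI:
  fixes F :: "real ^ 'n \<Rightarrow> real"
  assumes "GDERIV F u :> D"
  shows "grad F u = D"
  unfolding grad_def
proof (rule the_equality)
  show "GDERIV F u :> D" by fact
next
  fix D' assume "GDERIV F u :> D'"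
  then have "(\<lambda>h. h \<bullet> D') = (\<lambda>h. h \<bullet> D)"
    using assms unfolding gderiv_def by (rule has_derivative_unique)
  then show "D' = D" by (metis inner_commute vector_eq_rdot)
qed

lemma gderiv_grad:
  fixes F :: "real ^ 'n \<Rightarrow> real"
  assumes "F differentiable (at u)"
  shows "GDERIV F u :> grad F u"
proof -
  obtain F' where F': "(F has_derivative F') (at u)"
    using assms by (auto simp: differentiable_def)
  define D where "D = (\<Sum>b\<in>Basis. F' b *\<^sub>R b)"
  interpret F': bounded_linear F' using F' by (rule has_derivative_bounded_linear)
  have "F' = (\<lambda>h. h \<bullet> D)"
  proof
    fix h
    have "F' h = F' (\<Sum>b\<in>Basis. (h \<bullet> b) *\<^sub>R b)" by (simp add: euclidean_representation)
    also have "\<dots> = (\<Sum>b\<in>Basis. (h \<bullet> b) * F' b)" by (simp add: F'.sum F'.scaleR)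
    also have "\<dots> = h \<bullet> D" by (simp add: D_def inner_sum_right mult.commute)
    finally show "F' h = h \<bullet> D" .
  qed
  then have "GDERIV F u :> D" using F' unfolding gderiv_def by simp
  then show ?thesis using grad_eqI by metis
qed

(* infnorm is the maximum norm, dual to l1norm. *)
definition l1_smooth :: "real \<Rightarrow> (real ^ 'n \<Rightarrow> real) \<Rightarrow> bool" where
  "l1_smooth L F \<longleftrightarrow>
     (\<forall>u. F differentiable (at u)) \<and>
     (\<forall>u u'. infnorm (grad F u - grad F u') \<le> L * l1norm (u - u'))"

(* The sigma-algebra on space M generated by a i for i in I.  A supremum of
   vimage_algebras would have empty space when I is empty; here I = {} gives the
   trivial sigma-algebra on space M. *)
definition gen_subalg ::
  "'a measure \<Rightarrow> (nat \<Rightarrow> 'a \<Rightarrow> real ^ 'n) \<Rightarrow> nat set \<Rightarrow> 'a measure" where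
  "gen_subalg M a I = sigma (space M) (\<Union>i\<in>I. {a i -` B \<inter> space M | B. B \<in> sets borel})"

lemma subalgebra_gen_subalg:
  assumes "\<And>i. i \<in> I \<Longrightarrow> a i \<in> borel_measurable M"
  shows "subalgebra M (gen_subalg M a I)"
proof -
  let ?G = "\<Union>i\<in>I. {a i -` B \<inter> space M | B. B \<in> sets borel}"
  have "?G \<subseteq> sets M" using assms by (auto intro: measurable_sets)
  moreover have "?G \<subseteq> Pow (space M)" by blast
  ultimately show ?thesis
    unfolding subalgebra_def gen_subalg_def
    by (simp add: space_measure_of_conv sets_measure_of sets.sigma_sets_subset)
qed

(* real_cond_exp is scalar-valued, so vectors are conditioned componentwise. *)
definition vec_cond_exp ::
  "'a measure \<Rightarrow> 'a measure \<Rightarrow> ('a \<Rightarrow> real ^ 'n) \<Rightarrow> 'a \<Rightarrow> real ^ 'n" where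
  "vec_cond_exp M G X \<omega> = (\<chi> j. real_cond_exp M G (\<lambda>\<omega>'. X \<omega>' $ j) \<omega>)"

end

theory Submission imports Defs begin

text \<open>Expanding \<open>F\<close> to second order along the partial sums, the first-order terms are
  martingale differences, so \<open>\<bar>E F(a) - F(x)\<bar>\<close> is only \<open>2L/T\<close> for the averages \<open>a\<close>, \<open>x\<close>, and
  the same holds after translating both by a fixed vector.  A finite difference of step \<open>h\<close> in a
  coordinate direction recovers the partial derivative up to an error \<open>(4L/T)/h + L h\<close>, and
  \<open>h = 2 / sqrt T\<close> gives the claim.\<close>

section \<open>The l1 norm, its dual and the simplex\<close>

lemma l1norm_nonneg: "0 \<le> l1norm x"
  by (simp add: l1norm_def sum_nonneg)

lemma l1norm_scaleR: "l1norm (c *\<^sub>R x) = \<bar>c\<bar> * l1norm x"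
  by (simp add: l1norm_def abs_mult sum_distrib_left)

lemma l1norm_axis: "l1norm (axis j 1) = 1"
proof -
  have "l1norm (axis j (1::real)) = (\<Sum>i\<in>UNIV. if i = j then 1 else 0)"
    unfolding l1norm_def by (intro sum.cong) (auto simp: axis_def)
  then show ?thesis by simp
qed

lemma l1norm_le_norm: "l1norm (x :: real ^ 'n) \<le> real CARD('n) * norm x"
proof -
  have "l1norm x \<le> (\<Sum>j\<in>(UNIV :: 'n set). norm x)"
    unfolding l1norm_def by (intro sum_mono component_le_norm_cart)
  then show ?thesis by simp
qed

lemma l1norm_prob_simplex:
  assumes "x \<in> prob_simplex"
  shows "l1norm x = 1"
  using assms by (simp add: prob_simplex_def l1norm_def)

lemma l1norm_diff_prob_simplex:
  assumes "x \<in> prob_simplex" "y \<in> prob_simplex"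
  shows "l1norm (x - y) \<le> 2"
proof -
  have "l1norm (x - y) \<le> (\<Sum>j\<in>UNIV. \<bar>x $ j\<bar> + \<bar>y $ j\<bar>)"
    unfolding l1norm_def by (intro sum_mono) simp
  also have "\<dots> = l1norm x + l1norm y"
    by (simp add: l1norm_def sum.distrib)
  finally show ?thesis
    using assms by (simp add: l1norm_prob_simplex)
qed

lemma norm_prob_simplex_le:
  assumes "x \<in> prob_simplex"
  shows "norm x \<le> 1"
  using norm_le_l1_cart[of x] l1norm_prob_simplex[OF assms] by (simp add: l1norm_def)

text \<open>Hoelder's inequality for the dual pair of norms. It links the smoothness bound, stated
  in the maximum norm of the gradient, with increments measured in the l1 norm.\<close>

lemma abs_inner_le_infnorm_l1norm:
  fixes x y :: "real ^ 'n"
  shows "\<bar>x \<bullet> y\<bar> \<le> infnorm x * l1norm y"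
proof -
  have "\<bar>x \<bullet> y\<bar> \<le> (\<Sum>j\<in>UNIV. \<bar>x $ j\<bar> * \<bar>y $ j\<bar>)"
    unfolding inner_vec_def using sum_abs[of "\<lambda>j. x $ j * y $ j" UNIV] by (simp add: abs_mult)
  also have "\<dots> \<le> (\<Sum>j\<in>UNIV. infnorm x * \<bar>y $ j\<bar>)"
    by (intro sum_mono mult_right_mono component_le_infnorm_cart) simp
  finally show ?thesis by (simp add: l1norm_def sum_distrib_left)
qed

lemma infnorm_le_cart:
  fixes x :: "real ^ 'n"
  assumes "\<And>j. \<bar>x $ j\<bar> \<le> B"
  shows "infnorm x \<le> B"
  unfolding infnorm_cart using assms by (intro cSup_least) auto

section \<open>Analytic consequences of smoothness\<close>

text \<open>The sign of \<open>L\<close> is not part of \<open>l1_smooth\<close>. It follows by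
  testing the Lipschitz inequality on two points at l1 distance 1; \<open>undefined\<close> stands
  for an arbitrary coordinate.\<close>

lemma l1_smooth_nonneg:
  fixes F :: "real ^ 'n \<Rightarrow> real"
  assumes "l1_smooth L F"
  shows "0 \<le> L"
proof -
  have "infnorm (grad F (axis undefined 1) - grad F 0) \<le> L * l1norm (axis undefined 1 :: real ^ 'n)"
    using assms unfolding l1_smooth_def by (metis diff_zero)
  then show ?thesis
    using infnorm_pos_le[of "grad F (axis undefined 1) - grad F 0"] by (simp add: l1norm_axis)
qed

lemma l1_smooth_continuous:
  assumes "l1_smooth L F"
  shows "continuous_on UNIV F"
  using assms unfolding l1_smooth_def
  by (meson continuous_at_imp_continuous_on differentiable_imp_continuous_within)

text \<open>Equivalence of norms in finite dimension makes \<open>grad F\<close> Lipschitz in the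
  Euclidean norm. The constant depends on the dimension, but only the continuity is kept, to obtain
  measurability and integrability of gradients at random points.\<close>

lemma l1_smooth_grad_continuous:
  fixes F :: "real ^ 'n \<Rightarrow> real"
  assumes "l1_smooth L F"
  shows "continuous_on UNIV (grad F)"
proof -
  \<comment> \<open>The factor \<open>sqrt (real CARD('n))\<close> compares \<open>norm\<close> with
    \<open>infnorm\<close>, the factor \<open>real CARD('n)\<close> compares \<open>l1norm\<close>
    with \<open>norm\<close>.\<close>
  define C where "C = sqrt (real CARD('n)) * (L * real CARD('n))"
  have "C-lipschitz_on UNIV (grad F)"
  proof (rule lipschitz_onI)
    fix u u' :: "real ^ 'n"
    have "norm (grad F u - grad F u') \<le> sqrt (real CARD('n)) * infnorm (grad F u - grad F u')"
      using norm_le_infnorm[of "grad F u - grad F u'"] by simp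
    also have "\<dots> \<le> sqrt (real CARD('n)) * (L * l1norm (u - u'))"
      using assms by (intro mult_left_mono) (auto simp: l1_smooth_def)
    also have "\<dots> \<le> sqrt (real CARD('n)) * (L * (real CARD('n) * norm (u - u')))"
      using l1_smooth_nonneg[OF assms] by (intro mult_left_mono l1norm_le_norm) auto
    finally show "dist (grad F u) (grad F u') \<le> C * dist u u'"
      by (simp add: C_def dist_norm mult.assoc)
  qed (use l1_smooth_nonneg[OF assms] in \<open>simp add: C_def\<close>)
  then show ?thesis by (rule lipschitz_on_continuous_on)
qed

text \<open>Subtracting from \<open>g\<close> both its linear term at 0 and the parabola
  \<open>K / 2 * s\<^sup>2\<close> leaves a function with nonpositive derivative on [0,1]. Using the
  parabola, and not a uniform bound on the derivative, gives \<open>K / 2\<close> in place of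
  \<open>K\<close>.\<close>

lemma first_order_upper_bound:
  fixes g g' :: "real \<Rightarrow> real"
  assumes deriv: "\<And>s. (g has_real_derivative g' s) (at s)"
    and bound: "\<And>s. 0 \<le> s \<Longrightarrow> g' s - g' 0 \<le> K * s"
  shows "g 1 - g 0 - g' 0 \<le> K / 2"
proof -
  let ?p = "\<lambda>s. g s - s * g' 0 - K / 2 * s\<^sup>2"
  have "?p 1 \<le> ?p 0"
  proof (rule DERIV_nonpos_imp_nonincreasing[where f = ?p])
    fix s :: real assume "0 \<le> s" "s \<le> 1"
    have "(?p has_real_derivative g' s - g' 0 - K * s) (at s)"
      by (auto intro!: derivative_eq_intros deriv)
    then show "\<exists>y. (?p has_real_derivative y) (at s) \<and> y \<le> 0"
      using bound[OF \<open>0 \<le> s\<close>] by (intro exI[of _ "g' s - g' 0 - K * s"]) auto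
  qed simp
  then show ?thesis by simp
qed

text \<open>Restricting \<open>F\<close> to the segment from \<open>u\<close> to
  \<open>u + h\<close> reduces the claim to one variable, where the derivative grows away from its
  initial value at most linearly.\<close>

lemma l1_smooth_quadratic_bound:
  fixes F :: "real ^ 'n \<Rightarrow> real"
  assumes smooth: "l1_smooth L F"
  shows "\<bar>F (u + h) - F u - grad F u \<bullet> h\<bar> \<le> L / 2 * (l1norm h)\<^sup>2"
proof -
  define g where "g s = F (u + s *\<^sub>R h)" for s :: real
  define g' where "g' s = grad F (u + s *\<^sub>R h) \<bullet> h" for s :: real
  have deriv: "(g has_real_derivative g' s) (at s)" for s
  proof -
    have "GDERIV F (u + s *\<^sub>R h) :> grad F (u + s *\<^sub>R h)"
      using smooth by (intro gderiv_grad) (simp add: l1_smooth_def)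
    then have F': "(F has_derivative (\<lambda>k. k \<bullet> grad F (u + s *\<^sub>R h))) (at (u + s *\<^sub>R h))"
      by (simp add: gderiv_def)
    have "((\<lambda>s. u + s *\<^sub>R h) has_derivative (\<lambda>k. k *\<^sub>R h)) (at s)"
      by (auto intro!: derivative_eq_intros)
    from has_derivative_compose[OF this F'] show ?thesis
      unfolding has_field_derivative_def g_def g'_def
      by (simp add: inner_commute mult_commute_abs)
  qed
  \<comment> \<open>One factor \<open>l1norm h\<close> comes from Hoelder's inequality; the other,
    together with \<open>s\<close>, comes from smoothness over the displacement
    \<open>s *\<^sub>R h\<close>.\<close>
  have lip: "\<bar>g' s - g' 0\<bar> \<le> L * (l1norm h)\<^sup>2 * s" if "0 \<le> s" for s
  proof -
    have "\<bar>g' s - g' 0\<bar> \<le> infnorm (grad F (u + s *\<^sub>R h) - grad F u) * l1norm h"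
      using abs_inner_le_infnorm_l1norm[of "grad F (u + s *\<^sub>R h) - grad F u" h]
      by (simp add: g'_def inner_diff_left)
    also have "\<dots> \<le> (L * l1norm (u + s *\<^sub>R h - u)) * l1norm h"
      using smooth by (intro mult_right_mono l1norm_nonneg) (unfold l1_smooth_def, blast)
    finally show ?thesis
      using that by (simp add: l1norm_scaleR power2_eq_square algebra_simps)
  qed
  have "g 1 - g 0 - g' 0 \<le> L * (l1norm h)\<^sup>2 / 2"
    using lip by (intro first_order_upper_bound deriv) (auto simp: abs_le_iff)
  \<comment> \<open>The lower bound is the upper bound for \<open>- g\<close>.\<close>
  moreover have "- g 1 - - g 0 - - g' 0 \<le> L * (l1norm h)\<^sup>2 / 2"
    using lip
    by (intro first_order_upper_bound[where g = "\<lambda>s. - g s" and g' = "\<lambda>s. - g' s"]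
          DERIV_minus deriv) (auto simp: abs_le_iff)
  ultimately show ?thesis unfolding g_def g'_def abs_le_iff by simp
qed

section \<open>Measurability, integrability and conditioning\<close>

lemma measurable_gen_subalg:
  assumes "i \<in> I"
  shows "a i \<in> borel_measurable (gen_subalg M a I)"
proof (rule measurableI)
  let ?G = "\<Union>i\<in>I. {a i -` B \<inter> space M | B. B \<in> sets borel}"
  have G: "?G \<subseteq> Pow (space M)" by blast
  fix B :: "(real ^ 'b) set" assume "B \<in> sets borel"
  then have "a i -` B \<inter> space M \<in> ?G" using assms by blast
  then show "a i -` B \<inter> space (gen_subalg M a I) \<in> sets (gen_subalg M a I)"
    using G by (simp add: gen_subalg_def space_measure_of_conv)
qed simp

text \<open>A continuous function is bounded on the compact ball of radius \<open>B\<close>, so the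
  composition is almost surely bounded, and the measure is finite.\<close>

lemma (in finite_measure) integrable_continuous_bounded:
  fixes X :: "'a \<Rightarrow> real ^ 'n" and f :: "real ^ 'n \<Rightarrow> 'c :: {banach, second_countable_topology}"
  assumes f: "continuous_on UNIV f"
    and X: "X \<in> borel_measurable M" "AE \<omega> in M. norm (X \<omega>) \<le> B"
  shows "integrable M (\<lambda>\<omega>. f (X \<omega>))"
proof -
  have "compact (f ` cball 0 B)"
    using f by (intro compact_continuous_image) (auto intro: continuous_on_subset)
  then obtain C where C: "\<And>y. y \<in> cball 0 B \<Longrightarrow> norm (f y) \<le> C"
    by (metis bounded_iff compact_imp_bounded imageI)
  have "AE \<omega> in M. norm (f (X \<omega>)) \<le> C"
    using X(2) by eventually_elim (simp add: C)
  moreover have "(\<lambda>\<omega>. f (X \<omega>)) \<in> borel_measurable M"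
    using borel_measurable_continuous_onI[OF f] X(1) by simp
  ultimately show ?thesis by (intro integrable_const_bound)
qed

text \<open>A factor \<open>Y\<close> known from the past is orthogonal to an increment with
  conditional mean zero. The proof goes coordinate by coordinate, as \<open>vec_cond_exp\<close>
  does; boundedness of \<open>X\<close> makes the products integrable.\<close>

lemma (in prob_space) expectation_inner_cond_exp:
  fixes X Y :: "'a \<Rightarrow> real ^ 'n"
  assumes sub: "subalgebra M G"
    and Y: "Y \<in> borel_measurable G" "integrable M Y"
    and X: "X \<in> borel_measurable M" "AE \<omega> in M. norm (X \<omega>) \<le> B"
    and cond: "AE \<omega> in M. vec_cond_exp M G X \<omega> = c"
  shows "expectation (\<lambda>\<omega>. Y \<omega> \<bullet> (X \<omega> - c)) = 0"
proof -
  interpret finite_measure_subalgebra M G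
    by standard (rule sub)
  have nth: "(\<lambda>\<omega>. Z \<omega> $ j) \<in> borel_measurable N" if "Z \<in> borel_measurable N"
    for Z :: "'a \<Rightarrow> real ^ 'n" and N j
    using that by (rule measurable_compose) (rule borel_measurable_nth)
  have Yj: "integrable M (\<lambda>\<omega>. Y \<omega> $ j)" for j
    using Y(2) by (rule integrable_bounded_linear[OF bounded_linear_vec_nth])
  have Xj: "integrable M (\<lambda>\<omega>. Y \<omega> $ j * X \<omega> $ j)" for j
  proof (rule Bochner_Integration.integrable_bound)
    show "integrable M (\<lambda>\<omega>. Y \<omega> $ j * B)" using Yj by simp
    show "(\<lambda>\<omega>. Y \<omega> $ j * X \<omega> $ j) \<in> borel_measurable M"
      using Yj[of j] nth[OF X(1)] by simp
    show "AE \<omega> in M. norm (Y \<omega> $ j * X \<omega> $ j) \<le> norm (Y \<omega> $ j * B)"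
      using X(2)
    proof eventually_elim
      case (elim \<omega>)
      then have "\<bar>X \<omega> $ j\<bar> \<le> \<bar>B\<bar>"
        using component_le_norm_cart[of "X \<omega>" j] by linarith
      then show ?case by (simp add: abs_mult mult_left_mono)
    qed
  qed
  have zero: "expectation (\<lambda>\<omega>. Y \<omega> $ j * (X \<omega> $ j - c $ j)) = 0" for j
  proof -
    \<comment> \<open>Since \<open>Y\<close> is measurable for \<open>G\<close>, \<open>X\<close>
      may be replaced by its conditional expectation under the integral, and that is almost surely
      the constant \<open>c\<close>.\<close>
    have "expectation (\<lambda>\<omega>. Y \<omega> $ j * X \<omega> $ j)
        = expectation (\<lambda>\<omega>. Y \<omega> $ j * real_cond_exp M G (\<lambda>\<omega>. X \<omega> $ j) \<omega>)"
      using nth[OF Y(1)] nth[OF X(1)] Xj by (intro real_cond_exp_intg(2)[symmetric]) auto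
    also have "\<dots> = expectation (\<lambda>\<omega>. Y \<omega> $ j * c $ j)"
    proof (rule integral_cong_AE)
      show "AE \<omega> in M. Y \<omega> $ j * real_cond_exp M G (\<lambda>\<omega>. X \<omega> $ j) \<omega> = Y \<omega> $ j * c $ j"
        using cond by eventually_elim (auto simp: vec_cond_exp_def vec_eq_iff)
    qed (use Yj in auto)
    finally show ?thesis
      using Xj Yj by (simp add: right_diff_distrib)
  qed
  have int: "integrable M (\<lambda>\<omega>. Y \<omega> $ j * (X \<omega> $ j - c $ j))" for j
    using Xj Yj by (simp add: right_diff_distrib)
  have "(\<lambda>\<omega>. Y \<omega> \<bullet> (X \<omega> - c)) = (\<lambda>\<omega>. \<Sum>j\<in>UNIV. Y \<omega> $ j * (X \<omega> $ j - c $ j))"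
    by (simp add: inner_vec_def)
  then show ?thesis using int zero by (simp add: Bochner_Integration.integral_sum)
qed

section \<open>Second-order expansion along the martingale\<close>

text \<open>Induction on \<open>T\<close>: the linear term of each new increment has mean zero, so a
  step costs only its quadratic remainder, at most
  \<open>L / 2 * (2 * \<bar>c\<bar>)\<^sup>2\<close>. The base point \<open>v\<close> stays free so
  that the bound also applies at translated points.\<close>

lemma (in prob_space) abs_expectation_martingale_le:
  fixes F :: "real ^ 'n \<Rightarrow> real" and a :: "nat \<Rightarrow> 'a \<Rightarrow> real ^ 'n"
  assumes smooth: "l1_smooth L F"
    and x_simplex: "\<And>t. t \<in> {1..T} \<Longrightarrow> x t \<in> prob_simplex"
    and a_measurable: "\<And>t. t \<in> {1..T} \<Longrightarrow> a t \<in> borel_measurable M"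
    and a_simplex: "\<And>t. t \<in> {1..T} \<Longrightarrow> AE \<omega> in M. a t \<omega> \<in> prob_simplex"
    and a_cond_exp: "\<And>t. t \<in> {1..T} \<Longrightarrow>
          AE \<omega> in M. vec_cond_exp M (gen_subalg M a {1..<t}) (a t) \<omega> = x t"
  shows "\<bar>expectation (\<lambda>\<omega>. F (v + c *\<^sub>R (\<Sum>t\<in>{1..T}. a t \<omega> - x t))) - F v\<bar>
         \<le> real T * (2 * L * c\<^sup>2)"
  using x_simplex a_measurable a_simplex a_cond_exp
proof (induction T)
  case 0
  then show ?case by (simp add: prob_space)
next
  case (Suc n)
  define S where "S \<omega> = v + c *\<^sub>R (\<Sum>t\<in>{1..n}. a t \<omega> - x t)" for \<omega>
  define D where "D \<omega> = a (Suc n) \<omega> - x (Suc n)" for \<omega>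
  \<comment> \<open>The index set is 1 to \<open>n\<close>: exactly the past that determines
    \<open>S\<close>, and the conditioning assumed for \<open>a (Suc n)\<close>.\<close>
  define G where "G = gen_subalg M a {1..<Suc n}"
  have sub: "subalgebra M G"
    unfolding G_def using Suc.prems(2) by (intro subalgebra_gen_subalg) auto
  have S_G: "S \<in> borel_measurable G"
    unfolding S_def G_def
    by (intro borel_measurable_add borel_measurable_scaleR borel_measurable_sum
        borel_measurable_diff borel_measurable_const measurable_gen_subalg) auto
  have S_M: "S \<in> borel_measurable M"
    using measurable_from_subalg[OF sub S_G] .
  have D_M: "D \<in> borel_measurable M"
    unfolding D_def using Suc.prems(2)[of "Suc n"] by simp
  \<comment> \<open>The l1 bound enters the remainder estimate; the Euclidean one serves
    integrability.\<close>
  have D_le: "AE \<omega> in M. l1norm (a t \<omega> - x t) \<le> 2 \<and> norm (a t \<omega> - x t) \<le> 2"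
    if "t \<in> {1..Suc n}" for t
    using Suc.prems(3)[OF that]
  proof eventually_elim
    case (elim \<omega>)
    have "l1norm (a t \<omega> - x t) \<le> 2"
      by (rule l1norm_diff_prob_simplex[OF elim Suc.prems(1)[OF that]])
    then show ?case
      using norm_le_l1_cart[of "a t \<omega> - x t"] by (simp add: l1norm_def)
  qed
  have DD: "AE \<omega> in M. l1norm (D \<omega>) \<le> 2 \<and> norm (D \<omega>) \<le> 2"
    unfolding D_def by (rule D_le) simp
  have "AE \<omega> in M. \<forall>t\<in>{1..n}. l1norm (a t \<omega> - x t) \<le> 2 \<and> norm (a t \<omega> - x t) \<le> 2"
    by (intro AE_finite_allI D_le) auto
  \<comment> \<open>This bound grows with \<open>n\<close>, but it is used only for integrability
    and does not enter the estimate.\<close>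
  then have S_le: "AE \<omega> in M. norm (S \<omega>) \<le> norm v + \<bar>c\<bar> * (2 * real n)"
  proof eventually_elim
    case (elim \<omega>)
    have "norm (\<Sum>t\<in>{1..n}. a t \<omega> - x t) \<le> (\<Sum>t\<in>{1..n}. 2)"
      using elim by (intro sum_norm_le) auto
    then have "norm (c *\<^sub>R (\<Sum>t\<in>{1..n}. a t \<omega> - x t)) \<le> \<bar>c\<bar> * (2 * real n)"
      by (simp add: mult_left_mono mult.commute[of _ "2::real"])
    then show ?case
      unfolding S_def by (intro norm_triangle_le) simp
  qed
  have SD_le: "AE \<omega> in M. norm (S \<omega> + c *\<^sub>R D \<omega>) \<le> (norm v + \<bar>c\<bar> * (2 * real n)) + \<bar>c\<bar> * 2"
    using S_le DD
  proof eventually_elim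
    case (elim \<omega>)
    then have "norm (c *\<^sub>R D \<omega>) \<le> \<bar>c\<bar> * 2" by (simp add: mult_left_mono)
    with elim show ?case by (intro norm_triangle_le) linarith
  qed
  have int_S: "integrable M (\<lambda>\<omega>. F (S \<omega>))"
    by (rule integrable_continuous_bounded[OF l1_smooth_continuous[OF smooth] S_M S_le])
  have int_SD: "integrable M (\<lambda>\<omega>. F (S \<omega> + c *\<^sub>R D \<omega>))"
    by (rule integrable_continuous_bounded[OF l1_smooth_continuous[OF smooth] _ SD_le])
      (use S_M D_M in simp)
  have int_g: "integrable M (\<lambda>\<omega>. grad F (S \<omega>))"
    by (rule integrable_continuous_bounded[OF l1_smooth_grad_continuous[OF smooth] S_M S_le])
  have int_gD: "integrable M (\<lambda>\<omega>. grad F (S \<omega>) \<bullet> D \<omega>)"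
  proof (rule Bochner_Integration.integrable_bound)
    show "integrable M (\<lambda>\<omega>. norm (grad F (S \<omega>)) * 2)" using int_g by simp
    show "(\<lambda>\<omega>. grad F (S \<omega>) \<bullet> D \<omega>) \<in> borel_measurable M" using int_g D_M by simp
    show "AE \<omega> in M. norm (grad F (S \<omega>) \<bullet> D \<omega>) \<le> norm (norm (grad F (S \<omega>)) * 2)"
      using DD
    proof eventually_elim
      case (elim \<omega>)
      have "\<bar>grad F (S \<omega>) \<bullet> D \<omega>\<bar> \<le> norm (grad F (S \<omega>)) * norm (D \<omega>)"
        by (rule Cauchy_Schwarz_ineq2)
      also have "\<dots> \<le> norm (grad F (S \<omega>)) * 2" using elim by (intro mult_left_mono) auto
      finally show ?case by simp
    qed
  qed
  have "AE \<omega> in M. norm (a (Suc n) \<omega>) \<le> 1"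
    using Suc.prems(3)[of "Suc n"] by (auto elim!: eventually_mono intro: norm_prob_simplex_le)
  then have zero: "expectation (\<lambda>\<omega>. grad F (S \<omega>) \<bullet> D \<omega>) = 0"
    unfolding D_def using Suc.prems(2,4)[of "Suc n"]
      borel_measurable_continuous_onI[OF l1_smooth_grad_continuous[OF smooth]] S_G int_g
    by (intro expectation_inner_cond_exp[OF sub]) (auto simp: G_def)
  \<comment> \<open>\<open>R\<close> is the Taylor remainder of the last step. As the linear term
    has mean zero, its expectation is the change in the expected value of \<open>F\<close> caused by
    that step.\<close>
  define R where "R \<omega> = F (S \<omega> + c *\<^sub>R D \<omega>) - F (S \<omega>) - c * (grad F (S \<omega>) \<bullet> D \<omega>)" for \<omega>
  have int_R: "integrable M R"
    unfolding R_def using int_S int_SD int_gD by simp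
  have "AE \<omega> in M. \<bar>R \<omega>\<bar> \<le> 2 * L * c\<^sup>2"
    using DD
  proof eventually_elim
    case (elim \<omega>)
    have "\<bar>R \<omega>\<bar> \<le> L / 2 * (l1norm (c *\<^sub>R D \<omega>))\<^sup>2"
      using l1_smooth_quadratic_bound[OF smooth, of "S \<omega>" "c *\<^sub>R D \<omega>"] by (simp add: R_def)
    also have "\<dots> = L / 2 * c\<^sup>2 * (l1norm (D \<omega>))\<^sup>2"
      by (simp add: l1norm_scaleR power_mult_distrib)
    also have "\<dots> \<le> L / 2 * c\<^sup>2 * 2\<^sup>2"
      using elim l1norm_nonneg l1_smooth_nonneg[OF smooth]
      by (intro mult_left_mono power_mono) auto
    finally show ?case by simp
  qed
  then have "expectation (\<lambda>\<omega>. \<bar>R \<omega>\<bar>) \<le> 2 * L * c\<^sup>2"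
    using int_R by (intro integral_le_const) auto
  then have "\<bar>expectation R\<bar> \<le> 2 * L * c\<^sup>2"
    using integral_abs_bound[of M R] by linarith
  moreover have "expectation R = expectation (\<lambda>\<omega>. F (S \<omega> + c *\<^sub>R D \<omega>)) - expectation (\<lambda>\<omega>. F (S \<omega>))"
    unfolding R_def using int_S int_SD int_gD zero by simp
  moreover have "\<bar>expectation (\<lambda>\<omega>. F (S \<omega>)) - F v\<bar> \<le> real n * (2 * L * c\<^sup>2)"
    unfolding S_def using Suc.prems by (intro Suc.IH) auto
  moreover have "(\<lambda>\<omega>. F (v + c *\<^sub>R (\<Sum>t\<in>{1..Suc n}. a t \<omega> - x t))) = (\<lambda>\<omega>. F (S \<omega> + c *\<^sub>R D \<omega>))"
    by (simp add: S_def D_def algebra_simps)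
  moreover have "real (Suc n) * (2 * L * c\<^sup>2) = real n * (2 * L * c\<^sup>2) + 2 * L * c\<^sup>2"
    by (simp add: algebra_simps)
  ultimately show ?case by simp
qed

section \<open>From function values to gradients by finite differences\<close>

theorem corollary2p4:
  fixes F :: "real ^ 'n \<Rightarrow> real"
    and L :: real
    and T :: nat
    and M :: "'a measure"
    and x :: "nat \<Rightarrow> real ^ 'n"
    and a :: "nat \<Rightarrow> 'a \<Rightarrow> real ^ 'n"
  assumes smooth: "l1_smooth L F"
    and T: "T \<ge> 1"
    and M: "prob_space M"
    and x_simplex: "\<And>t. t \<in> {1..T} \<Longrightarrow> x t \<in> prob_simplex"
    and a_measurable: "\<And>t. t \<in> {1..T} \<Longrightarrow> a t \<in> borel_measurable M"
    and a_simplex: "\<And>t. t \<in> {1..T} \<Longrightarrow> AE \<omega> in M. a t \<omega> \<in> prob_simplex"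
    and a_cond_exp: "\<And>t. t \<in> {1..T} \<Longrightarrow>
          AE \<omega> in M. vec_cond_exp M (gen_subalg M a {1..<t}) (a t) \<omega> = x t"
  shows "infnorm (prob_space.expectation M (\<lambda>\<omega>.
             grad F ((1 / real T) *\<^sub>R (\<Sum>t\<in>{1..T}. a t \<omega>))
           - grad F ((1 / real T) *\<^sub>R (\<Sum>t\<in>{1..T}. x t))))
         \<le> 4 * L / sqrt (real T)"
proof -
  interpret prob_space M by (rule M)
  note mart = abs_expectation_martingale_le[where T = T,
      OF smooth x_simplex a_measurable a_simplex a_cond_exp]
  define A where "A \<omega> = (1 / real T) *\<^sub>R (\<Sum>t\<in>{1..T}. a t \<omega>)" for \<omega>
  define X where "X = (1 / real T) *\<^sub>R (\<Sum>t\<in>{1..T}. x t)"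
  \<comment> \<open>This step minimizes \<open>4 * L / (real T * h) + L * h\<close>, making both
    summands equal to \<open>2 * L / sqrt (real T)\<close>.\<close>
  define h where "h = 2 / sqrt (real T)"
  have h_pos: "h > 0" and h_sq: "h\<^sup>2 = 4 / real T"
    using T by (auto simp: h_def power_divide)
  have A_M: "A \<in> borel_measurable M"
    unfolding A_def using a_measurable by simp
  have "AE \<omega> in M. \<forall>t\<in>{1..T}. a t \<omega> \<in> prob_simplex"
    by (intro AE_finite_allI a_simplex) auto
  then have A_le: "AE \<omega> in M. norm (A \<omega>) \<le> 1"
  proof eventually_elim
    case (elim \<omega>)
    have "norm (\<Sum>t\<in>{1..T}. a t \<omega>) \<le> (\<Sum>t\<in>{1..T}. 1)"
      using elim by (intro sum_norm_le norm_prob_simplex_le) auto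
    then show ?case using T by (simp add: A_def field_simps)
  qed
  have int_grad: "integrable M (\<lambda>\<omega>. grad F (A \<omega>))"
    by (rule integrable_continuous_bounded[OF l1_smooth_grad_continuous[OF smooth] A_M A_le])
  have int_F: "integrable M (\<lambda>\<omega>. F (w + A \<omega>))" for w
  proof (rule integrable_continuous_bounded[OF _ A_M A_le, of "\<lambda>y. F (w + y)"])
    show "continuous_on UNIV (\<lambda>y. F (w + y))"
      by (rule continuous_on_compose2[OF l1_smooth_continuous[OF smooth]])
        (auto intro: continuous_intros)
  qed
  \<comment> \<open>With scale \<open>1 / real T\<close> each of the \<open>T\<close> steps costs
    \<open>2 * L / (real T)\<^sup>2\<close>. Only the shifts \<open>w = 0\<close> and
    \<open>w = ?e\<close> are needed, the two ends of the finite difference.\<close>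
  have transl: "\<bar>expectation (\<lambda>\<omega>. F (w + A \<omega>)) - F (w + X)\<bar> \<le> 2 * L / real T" for w
  proof -
    have "(w + X) + (1 / real T) *\<^sub>R (\<Sum>t\<in>{1..T}. a t \<omega> - x t) = w + A \<omega>" for \<omega>
      by (simp add: A_def X_def sum_subtractf scaleR_diff_right)
    moreover have "real T * (2 * L * (1 / real T)\<^sup>2) = 2 * L / real T"
      using T by (simp add: power2_eq_square)
    ultimately show ?thesis
      using mart[where v = "w + X" and c = "1 / real T"] by (simp only:)
  qed
  have "\<bar>expectation (\<lambda>\<omega>. grad F (A \<omega>) - grad F X) $ j\<bar> \<le> 4 * L / sqrt (real T)" for j
  proof -
    let ?e = "h *\<^sub>R axis j 1 :: real ^ 'n"
    let ?g = "\<lambda>\<omega>. grad F (A \<omega>) $ j"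
    have int_g: "integrable M ?g"
      using int_grad by (rule integrable_bounded_linear[OF bounded_linear_vec_nth])
    have taylor: "\<bar>F (?e + u) - F u - h * grad F u $ j\<bar> \<le> L / 2 * h\<^sup>2" for u
      using l1_smooth_quadratic_bound[OF smooth, of u ?e]
      by (simp add: l1norm_scaleR l1norm_axis inner_axis add.commute)
    \<comment> \<open>This is the finite-difference error at the random point
      \<open>A \<omega>\<close>; the bound \<open>taylor\<close> is uniform in \<open>u\<close>, so
      it survives taking expectations.\<close>
    define R where "R \<omega> = F (?e + A \<omega>) - F (A \<omega>) - h * ?g \<omega>" for \<omega>
    have int_R: "integrable M R"
      unfolding R_def using int_F[of ?e] int_F[of 0] int_g by simp
    have "expectation (\<lambda>\<omega>. \<bar>R \<omega>\<bar>) \<le> L / 2 * h\<^sup>2"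
      using int_R taylor unfolding R_def by (intro integral_le_const) auto
    then have "\<bar>expectation R\<bar> \<le> L / 2 * h\<^sup>2"
      using integral_abs_bound[of M R] by linarith
    moreover have "expectation R
        = expectation (\<lambda>\<omega>. F (?e + A \<omega>)) - expectation (\<lambda>\<omega>. F (A \<omega>)) - h * expectation ?g"
      unfolding R_def using int_F[of ?e] int_F[of 0] int_g by simp
    \<comment> \<open>Four errors add up: \<open>2 * L / real T\<close> for each shift
      \<open>?e\<close> and 0, and \<open>L / 2 * h\<^sup>2\<close> for each of the Taylor
      expansions at \<open>A \<omega>\<close> and at \<open>X\<close>.\<close>
    ultimately have "\<bar>h * expectation ?g - h * grad F X $ j\<bar> \<le> 4 * L / real T + L * h\<^sup>2"
      using transl[of ?e] transl[of 0] taylor[of X] unfolding abs_le_iff by simp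
    then have "h * \<bar>expectation ?g - grad F X $ j\<bar> \<le> 4 * L / real T + L * h\<^sup>2"
      using h_pos by (simp add: abs_mult flip: right_diff_distrib)
    also have "\<dots> = h * (4 * L / sqrt (real T))"
      using T by (simp add: h_sq) (simp add: h_def field_simps)
    finally have "\<bar>expectation ?g - grad F X $ j\<bar> \<le> 4 * L / sqrt (real T)"
      by (rule mult_left_le_imp_le) (rule h_pos)
    moreover have "expectation (\<lambda>\<omega>. grad F (A \<omega>) - grad F X) $ j = expectation ?g - grad F X $ j"
    \<comment> \<open>The coordinate projection is bounded and linear, so it commutes with the
      vector-valued integral.\<close>
    proof -
      have "expectation (\<lambda>\<omega>. grad F (A \<omega>) - grad F X) $ j
          = expectation (\<lambda>\<omega>. (grad F (A \<omega>) - grad F X) $ j)"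
        using int_grad by (intro integral_bounded_linear[OF bounded_linear_vec_nth, symmetric]) auto
      then show ?thesis using int_g by (simp add: prob_space)
    qed
    ultimately show ?thesis by simp
  qed
  then show ?thesis
    unfolding A_def X_def by (rule infnorm_le_cart)
qed

end
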